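(* There exist a finite signature of binary relation symbols and a first-order sentence $\chi$ over it such that $\chi$ is preserved under taking generated subframes over finite frames, but $\chi$ is not equivalent over finite frames to any $\exists$-bounded first-order sentence.
   Context: A frame is a structure $(W,(R_a)_{a\in A})$ with binary relations only. $F=(W,(R_a))$ is a generated subframe of $G=(W',(R'_a))$ if $F$ is an induced substructure of $G$ and for all $a$ and $(w,v)\in R'_a$, if $w\in W$ then $v\in W$. $\chi$ is preserved under generated subframes over finite frames if whenever $G$ is a finite frame with $G\models\chi$ and $F$ is a generated subframe of $G$, then $F\models\chi$. A first-order formula is $\exists$-bounded if it is built from literals (atomic formulas, including equalities, and their negations) using $\land$, $\lor$, bounded quantifiers $\exists x(R(y,x)\land\cdots)$ and $\forall x(R(y,x)\to\cdots)$ with $R$ a binary relation symbol and $y$ a variable distinct from $x$, and unbounded universal quantifiers $\forall x$. *)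

theory Defs
  imports Main
begin

record ('a, 'w) frame =
  worlds :: "'w set"
  rel :: "'a \<Rightarrow> ('w \<times> 'w) set"

text \<open>Only the relations indexed by the signature \<open>A\<close> matter. As usual for first-order
  structures, the domain is nonempty.\<close>

definition is_frame :: "'a set \<Rightarrow> ('a, 'w) frame \<Rightarrow> bool" where
  "is_frame A F \<longleftrightarrow> worlds F \<noteq> {} \<and> (\<forall>a\<in>A. rel F a \<subseteq> worlds F \<times> worlds F)"

definition finite_frame :: "'a set \<Rightarrow> ('a, 'w) frame \<Rightarrow> bool" where
  "finite_frame A F \<longleftrightarrow> is_frame A F \<and> finite (worlds F)"

definition induced_substructure :: "'a set \<Rightarrow> ('a, 'w) frame \<Rightarrow> ('a, 'w) frame \<Rightarrow> bool" where
  "induced_substructure A F G \<longleftrightarrow> is_frame A F \<and> is_frame A G \<and> worlds F \<subseteq> worlds G \<and>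
     (\<forall>a\<in>A. rel F a = rel G a \<inter> (worlds F \<times> worlds F))"

definition generated_subframe :: "'a set \<Rightarrow> ('a, 'w) frame \<Rightarrow> ('a, 'w) frame \<Rightarrow> bool" where
  "generated_subframe A F G \<longleftrightarrow> induced_substructure A F G \<and>
     (\<forall>a\<in>A. \<forall>(w, v)\<in>rel G a. w \<in> worlds F \<longrightarrow> v \<in> worlds F)"

datatype (symbols: 'a) fm =
    Rel 'a nat nat
  | Eq nat nat
  | Neg "'a fm"
  | Conj "'a fm" "'a fm"
  | Disj "'a fm" "'a fm"
  | Imp "'a fm" "'a fm"
  | Ex nat "'a fm"
  | All nat "'a fm"

primrec free_vars :: "'a fm \<Rightarrow> nat set" where
  "free_vars (Rel a x y) = {x, y}"
| "free_vars (Eq x y) = {x, y}"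
| "free_vars (Neg p) = free_vars p"
| "free_vars (Conj p q) = free_vars p \<union> free_vars q"
| "free_vars (Disj p q) = free_vars p \<union> free_vars q"
| "free_vars (Imp p q) = free_vars p \<union> free_vars q"
| "free_vars (Ex x p) = free_vars p - {x}"
| "free_vars (All x p) = free_vars p - {x}"

definition sentence :: "'a set \<Rightarrow> 'a fm \<Rightarrow> bool" where
  "sentence A p \<longleftrightarrow> symbols p \<subseteq> A \<and> free_vars p = {}"

primrec sat :: "('a, 'w) frame \<Rightarrow> (nat \<Rightarrow> 'w) \<Rightarrow> 'a fm \<Rightarrow> bool" where
  "sat F e (Rel a x y) \<longleftrightarrow> (e x, e y) \<in> rel F a"
| "sat F e (Eq x y) \<longleftrightarrow> e x = e y"
| "sat F e (Neg p) \<longleftrightarrow> \<not> sat F e p"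
| "sat F e (Conj p q) \<longleftrightarrow> sat F e p \<and> sat F e q"
| "sat F e (Disj p q) \<longleftrightarrow> sat F e p \<or> sat F e q"
| "sat F e (Imp p q) \<longleftrightarrow> (sat F e p \<longrightarrow> sat F e q)"
| "sat F e (Ex x p) \<longleftrightarrow> (\<exists>w\<in>worlds F. sat F (e(x := w)) p)"
| "sat F e (All x p) \<longleftrightarrow> (\<forall>w\<in>worlds F. sat F (e(x := w)) p)"

definition models :: "('a, 'w) frame \<Rightarrow> 'a fm \<Rightarrow> bool" (infix "\<Turnstile>" 50) where
  "F \<Turnstile> p \<longleftrightarrow> (\<forall>e. range e \<subseteq> worlds F \<longrightarrow> sat F e p)"

inductive ex_bounded :: "'a fm \<Rightarrow> bool" where
  "ex_bounded (Rel a x y)"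
| "ex_bounded (Neg (Rel a x y))"
| "ex_bounded (Eq x y)"
| "ex_bounded (Neg (Eq x y))"
| "ex_bounded p \<Longrightarrow> ex_bounded q \<Longrightarrow> ex_bounded (Conj p q)"
| "ex_bounded p \<Longrightarrow> ex_bounded q \<Longrightarrow> ex_bounded (Disj p q)"
| "y \<noteq> x \<Longrightarrow> ex_bounded p \<Longrightarrow> ex_bounded (Ex x (Conj (Rel a y x) p))"
| "y \<noteq> x \<Longrightarrow> ex_bounded p \<Longrightarrow> ex_bounded (All x (Imp (Rel a y x) p))"
| "ex_bounded p \<Longrightarrow> ex_bounded (All x p)"

text \<open>Quantification over all finite frames is rendered by quantification over finite frames
  whose worlds are natural numbers; every finite frame is isomorphic to one of these. The lemmas
  at the end show that both notions then hold for frames over an arbitrary type of worlds.\<close>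

definition preserved_generated_subframes_fin :: "'a set \<Rightarrow> 'a fm \<Rightarrow> bool" where
  "preserved_generated_subframes_fin A p \<longleftrightarrow>
     (\<forall>F G :: ('a, nat) frame.
        finite_frame A G \<and> G \<Turnstile> p \<and> generated_subframe A F G \<longrightarrow> F \<Turnstile> p)"

definition equivalent_fin :: "'a set \<Rightarrow> 'a fm \<Rightarrow> 'a fm \<Rightarrow> bool" where
  "equivalent_fin A p q \<longleftrightarrow> (\<forall>F :: ('a, nat) frame. finite_frame A F \<longrightarrow> (F \<Turnstile> p \<longleftrightarrow> F \<Turnstile> q))"

definition image_frame :: "('w \<Rightarrow> 'v) \<Rightarrow> ('a, 'w) frame \<Rightarrow> ('a, 'v) frame" where
  "image_frame h F = \<lparr>worlds = h ` worlds F, rel = (\<lambda>a. map_prod h h ` rel F a)\<rparr>"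

lemma sat_image_frame:
  assumes "is_frame A F" "inj_on h (worlds F)" "symbols p \<subseteq> A" "range e \<subseteq> worlds F"
  shows "sat (image_frame h F) (h \<circ> e) p \<longleftrightarrow> sat F e p"
  using assms(3,4)
proof (induction p arbitrary: e)
  case (Rel a x y)
  have W: "e x \<in> worlds F" "e y \<in> worlds F" using Rel by auto
  have R: "rel F a \<subseteq> worlds F \<times> worlds F" using assms(1) Rel by (auto simp: is_frame_def)
  have "(e x, e y) \<in> rel F a" if uv: "(u, v) \<in> rel F a" and "h (e x) = h u" "h (e y) = h v" for u v
  proof -
    have "u \<in> worlds F" "v \<in> worlds F" using uv R by auto
    then have "e x = u" "e y = v" using that W assms(2) by (auto dest: inj_onD)
    then show ?thesis using uv by simp
  qed
  then show ?case by (force simp: image_frame_def)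
next
  case (Eq x y)
  have "e x \<in> worlds F" "e y \<in> worlds F" using Eq by auto
  then show ?case using assms(2) by (auto simp: inj_on_eq_iff)
next
  case (Ex x p)
  have "sat (image_frame h F) ((h \<circ> e)(x := h w)) p \<longleftrightarrow> sat F (e(x := w)) p"
    if "w \<in> worlds F" for w
  proof -
    have "range (e(x := w)) \<subseteq> worlds F" using that Ex.prems by auto
    then show ?thesis using Ex.IH[of "e(x := w)"] Ex.prems by (simp only: fun_upd_comp fm.set)
  qed
  then show ?case by (simp add: image_frame_def comp_def)
next
  case (All x p)
  have "sat (image_frame h F) ((h \<circ> e)(x := h w)) p \<longleftrightarrow> sat F (e(x := w)) p"
    if "w \<in> worlds F" for w
  proof -
    have "range (e(x := w)) \<subseteq> worlds F" using that All.prems by auto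
    then show ?thesis using All.IH[of "e(x := w)"] All.prems by (simp only: fun_upd_comp fm.set)
  qed
  then show ?case by (simp add: image_frame_def comp_def)
qed auto

lemma models_image_frame:
  assumes "is_frame A F" "inj_on h (worlds F)" "symbols p \<subseteq> A"
  shows "image_frame h F \<Turnstile> p \<longleftrightarrow> F \<Turnstile> p"
proof
  assume L: "image_frame h F \<Turnstile> p"
  show "F \<Turnstile> p" unfolding models_def
  proof (intro allI impI)
    fix e :: "nat \<Rightarrow> _" assume e: "range e \<subseteq> worlds F"
    then have "range (h \<circ> e) \<subseteq> worlds (image_frame h F)" by (auto simp: image_frame_def)
    then show "sat F e p" using L sat_image_frame[OF assms e] by (auto simp: models_def)
  qed
next
  assume R: "F \<Turnstile> p"
  show "image_frame h F \<Turnstile> p" unfolding models_def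
  proof (intro allI impI)
    fix e :: "nat \<Rightarrow> _" assume "range e \<subseteq> worlds (image_frame h F)"
    then have m: "e n \<in> h ` worlds F" for n by (auto simp: image_frame_def)
    define d where "d = inv_into (worlds F) h \<circ> e"
    have d: "range d \<subseteq> worlds F" using m by (auto simp: d_def intro: inv_into_into)
    have "h \<circ> d = e" using m by (auto simp: d_def f_inv_into_f)
    then show "sat (image_frame h F) e p"
      using sat_image_frame[OF assms d] R d by (auto simp: models_def)
  qed
qed

lemma finite_frame_image:
  assumes "finite_frame A F" shows "finite_frame A (image_frame h F)"
  using assms by (fastforce simp: finite_frame_def is_frame_def image_frame_def)

lemma equivalent_fin_any_type:
  fixes F :: "('a, 'w) frame"
  assumes "equivalent_fin A p q" "symbols p \<subseteq> A" "symbols q \<subseteq> A" "finite_frame A F"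
  shows "F \<Turnstile> p \<longleftrightarrow> F \<Turnstile> q"
proof -
  have F: "is_frame A F" "finite (worlds F)" using assms(4) by (auto simp: finite_frame_def)
  obtain h :: "'w \<Rightarrow> nat" where h: "inj_on h (worlds F)"
    using finite_imp_inj_to_nat_seg[OF F(2)] by blast
  have "image_frame h F \<Turnstile> p \<longleftrightarrow> image_frame h F \<Turnstile> q"
    using assms(1) finite_frame_image[OF assms(4)] by (auto simp: equivalent_fin_def)
  then show ?thesis using models_image_frame[OF F(1) h] assms(2,3) by blast
qed

lemma generated_subframe_image:
  assumes gen: "generated_subframe A F G" and h: "inj_on h (worlds G)"
  shows "generated_subframe A (image_frame h F) (image_frame h G)"
proof -
  have sub: "worlds F \<subseteq> worlds G" and FF: "is_frame A F" and GG: "is_frame A G"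
    and eq: "\<And>a. a \<in> A \<Longrightarrow> rel F a = rel G a \<inter> (worlds F \<times> worlds F)"
    and cl: "\<And>a w v. a \<in> A \<Longrightarrow> (w, v) \<in> rel G a \<Longrightarrow> w \<in> worlds F \<Longrightarrow> v \<in> worlds F"
    using gen by (auto simp: generated_subframe_def induced_substructure_def)
  have G: "w \<in> worlds G" "v \<in> worlds G" if "a \<in> A" "(w, v) \<in> rel G a" for a w v
    using GG that by (auto simp: is_frame_def)
  have pull: "w \<in> worlds F" if "w \<in> worlds G" "h w \<in> h ` worlds F" for w
    using that h sub by (auto dest: inj_onD)
  have ff: "is_frame A (image_frame h F)" "is_frame A (image_frame h G)"
    using FF GG by (fastforce simp: is_frame_def image_frame_def)+
  have "map_prod h h ` rel F a = map_prod h h ` rel G a \<inter> (h ` worlds F \<times> h ` worlds F)"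
    if a: "a \<in> A" for a
  proof (intro equalityI subsetI)
    fix z assume z: "z \<in> map_prod h h ` rel G a \<inter> (h ` worlds F \<times> h ` worlds F)"
    then obtain w v where wv: "(w, v) \<in> rel G a" "z = (h w, h v)" by auto
    have "z \<in> h ` worlds F \<times> h ` worlds F" using z by simp
    then have "h w \<in> h ` worlds F" "h v \<in> h ` worlds F" using wv(2) by simp_all
    then have "(w, v) \<in> rel F a" using pull G[OF a wv(1)] wv(1) eq[OF a] by simp
    then show "z \<in> map_prod h h ` rel F a" using wv(2) by force
  qed (auto simp: eq[OF a])
  moreover have "h v \<in> h ` worlds F"
    if "a \<in> A" "(w, v) \<in> rel G a" "h w \<in> h ` worlds F" for a w v
    using pull G cl that by blast
  ultimately show ?thesis
    using ff sub by (auto simp: generated_subframe_def induced_substructure_def image_frame_def)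
qed

lemma preserved_generated_subframes_fin_any_type:
  fixes F G :: "('a, 'w) frame"
  assumes "preserved_generated_subframes_fin A p" "symbols p \<subseteq> A"
    and "finite_frame A G" "G \<Turnstile> p" "generated_subframe A F G"
  shows "F \<Turnstile> p"
proof -
  have G: "is_frame A G" "finite (worlds G)" using assms(3) by (auto simp: finite_frame_def)
  have F: "is_frame A F" "worlds F \<subseteq> worlds G"
    using assms(5) by (auto simp: generated_subframe_def induced_substructure_def)
  obtain h :: "'w \<Rightarrow> nat" where h: "inj_on h (worlds G)"
    using finite_imp_inj_to_nat_seg[OF G(2)] by blast
  have "image_frame h G \<Turnstile> p" using models_image_frame[OF G(1) h assms(2)] assms(4) by simp
  then have "image_frame h F \<Turnstile> p"
    using assms(1) finite_frame_image[OF assms(3)] generated_subframe_image[OF assms(5) h]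
    unfolding preserved_generated_subframes_fin_def by blast
  then show ?thesis
    using models_image_frame[OF F(1) inj_on_subset[OF h F(2)] assms(2)] by simp
qed

end

theory Submission
  imports Defs
begin

text \<open>
  The reflexive worlds of a frame are its \<^emph>\<open>points\<close>; every world represents the set of points it
  sees. The sentence \<open>\<chi>\<close> says that the points form a clique and that not every set of
  points is represented, where over finite frames ``every set is represented'' is expressed by a
  first-order closure condition under adding one point. In a generated superframe with a clique of
  points no new point can occur, so a frame violating \<open>\<chi>\<close> keeps violating it.

  An \<open>\<exists>\<close>-bounded sentence corresponds to a game in which the worlds of the larger frame are only
  explored along the relation. As all successors are points, a missing set is never noticed there:
  all subsets of an \<open>N\<close>-element clique are imitated by the sets of at most \<open>N\<close> points, and their
  complements, of a clique with \<open>2 * N + 2\<close> points, where the surplus points always follow the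
  majority of a large block of points not yet distinguished from one another.
\<close>

section \<open>The sentence and its preservation\<close>

definition points :: "(nat, 'w) frame \<Rightarrow> 'w set" where
  "points F = {x \<in> worlds F. (x, x) \<in> rel F 0}"

definition clique :: "(nat, 'w) frame \<Rightarrow> bool" where
  "clique F \<longleftrightarrow> (\<forall>x\<in>points F. \<forall>y\<in>points F. (x, y) \<in> rel F 0)"

text \<open>Requiring a point makes the condition usable for preservation: from a single point
  inside a generated subframe, the clique edges reach all points of the larger frame.\<close>

definition insert_closed :: "(nat, 'w) frame \<Rightarrow> bool" where
  "insert_closed F \<longleftrightarrow> points F \<noteq> {} \<and>
     (\<exists>u\<in>worlds F. \<forall>z\<in>points F. (u, z) \<notin> rel F 0) \<and>
     (\<forall>u\<in>worlds F. \<forall>x\<in>points F. \<exists>v\<in>worlds F. \<forall>z\<in>points F.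
        (v, z) \<in> rel F 0 \<longleftrightarrow> (u, z) \<in> rel F 0 \<or> z = x)"

definition clique_fm :: "nat fm" where
  "clique_fm = All 0 (All 1 (Imp (Conj (Rel 0 0 0) (Rel 0 1 1)) (Rel 0 0 1)))"

definition insert_closed_fm :: "nat fm" where
  "insert_closed_fm =
     Conj (Ex 0 (Rel 0 0 0))
    (Conj (Ex 0 (All 1 (Imp (Rel 0 1 1) (Neg (Rel 0 0 1)))))
          (All 0 (All 1 (Imp (Rel 0 1 1) (Ex 2 (All 3 (Imp (Rel 0 3 3)
             (Conj (Imp (Rel 0 2 3) (Disj (Rel 0 0 3) (Eq 3 1)))
                   (Imp (Disj (Rel 0 0 3) (Eq 3 1)) (Rel 0 2 3))))))))))"

definition chi :: "nat fm" where
  "chi = Conj clique_fm (Neg insert_closed_fm)"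

lemma sentence_chi: "sentence {0} chi"
  by (auto simp: sentence_def chi_def clique_fm_def insert_closed_fm_def)

lemma sat_clique_fm: "sat F e clique_fm \<longleftrightarrow> clique F"
  by (auto simp: clique_fm_def clique_def points_def)

lemma sat_insert_closed_fm: "sat F e insert_closed_fm \<longleftrightarrow> insert_closed F"
proof -
  have ball: "(\<forall>x\<in>points F. Q x) \<longleftrightarrow> (\<forall>x\<in>worlds F. (x, x) \<in> rel F 0 \<longrightarrow> Q x)" for Q
    by (auto simp: points_def)
  have "points F \<noteq> {} \<longleftrightarrow> (\<exists>x\<in>worlds F. (x, x) \<in> rel F 0)"
    by (auto simp: points_def)
  then show ?thesis
    by (simp add: insert_closed_fm_def insert_closed_def ball iff_conv_conj_imp[of "_ \<in> _" "_ \<or> _"])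
qed

lemma models_chi:
  assumes "worlds F \<noteq> {}"
  shows "F \<Turnstile> chi \<longleftrightarrow> clique F \<and> \<not> insert_closed F"
proof -
  obtain w where "w \<in> worlds F" using assms by blast
  then have "range (\<lambda>_ :: nat. w) \<subseteq> worlds F" by auto
  then show ?thesis
    unfolding models_def by (auto simp: chi_def sat_clique_fm sat_insert_closed_fm)
qed

text \<open>Start with a world that sees no points and add the elements of \<open>X\<close> one at a
  time; this is where finiteness enters.\<close>

lemma insert_closed_represents:
  assumes "insert_closed F" "finite X" "X \<subseteq> points F"
  shows "\<exists>u\<in>worlds F. \<forall>z\<in>points F. (u, z) \<in> rel F 0 \<longleftrightarrow> z \<in> X"
  using assms(2,3)
proof (induction X)
  case empty
  then show ?case using assms(1) by (auto simp: insert_closed_def)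
next
  case (insert x X)
  then obtain u where u: "u \<in> worlds F" "\<forall>z\<in>points F. (u, z) \<in> rel F 0 \<longleftrightarrow> z \<in> X" by auto
  moreover have "x \<in> points F" using insert.prems by simp
  ultimately obtain v where "v \<in> worlds F"
    "\<forall>z\<in>points F. (v, z) \<in> rel F 0 \<longleftrightarrow> (u, z) \<in> rel F 0 \<or> z = x"
    using assms(1) unfolding insert_closed_def by blast
  then show ?case using u(2) by (intro bexI[of _ v]) auto
qed

text \<open>The clique condition restricts to subframes. If \<open>F\<close> were insert-closed, it
  would contain all points of \<open>G\<close>, and its worlds would represent every set of them in
  \<open>G\<close> as well, contradicting \<open>chi\<close> in \<open>G\<close>.\<close>

lemma preserved_chi: "preserved_generated_subframes_fin {0} chi"
  unfolding preserved_generated_subframes_fin_def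
proof (intro allI impI, elim conjE)
  fix F G :: "(nat, nat) frame"
  assume fin: "finite_frame {0} G" and G: "G \<Turnstile> chi" and gen: "generated_subframe {0} F G"
  have sub: "worlds F \<subseteq> worlds G" and ne: "worlds F \<noteq> {}" "worlds G \<noteq> {}"
    and eq: "rel F 0 = rel G 0 \<inter> (worlds F \<times> worlds F)"
    and cl: "\<And>w v. (w, v) \<in> rel G 0 \<Longrightarrow> w \<in> worlds F \<Longrightarrow> v \<in> worlds F"
    using gen by (auto simp: generated_subframe_def induced_substructure_def is_frame_def)
  have cG: "clique G" and nG: "\<not> insert_closed G" using G models_chi[OF ne(2)] by auto
  have pF: "points F = points G \<inter> worlds F" using sub eq by (auto simp: points_def)
  have cF: "clique F" using cG pF eq by (auto simp: clique_def)
  have "\<not> insert_closed F"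
  proof
    assume full: "insert_closed F"
    then obtain p where p: "p \<in> points F" by (auto simp: insert_closed_def)
    \<comment> \<open>In \<open>G\<close> the point \<open>p\<close> sees every point, and
      successors of worlds of \<open>F\<close> stay in \<open>F\<close>.\<close>
    have "y \<in> worlds F" if "y \<in> points G" for y
      using that p pF cG cl[of p y] by (auto simp: clique_def)
    then have pts: "points G = points F" using pF by auto
    have finp: "finite (points G)" using fin by (auto simp: points_def finite_frame_def)
    have relF: "(u, z) \<in> rel F 0 \<longleftrightarrow> (u, z) \<in> rel G 0" if "u \<in> worlds F" "z \<in> points G" for u z
    proof -
      have "z \<in> worlds F" using that(2) pts pF by blast
      then show ?thesis using that(1) by (simp add: eq)
    qed
    have rep: "\<exists>u\<in>worlds G. \<forall>z\<in>points G. (u, z) \<in> rel G 0 \<longleftrightarrow> z \<in> X" if X: "X \<subseteq> points G" for X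
    proof -
      have "finite X" using X finp finite_subset by blast
      then obtain u where "u \<in> worlds F" "\<forall>z\<in>points F. (u, z) \<in> rel F 0 \<longleftrightarrow> z \<in> X"
        using insert_closed_represents[OF full, of X] X pts by auto
      then show ?thesis using sub relF pts by (intro bexI[of _ u]) blast+
    qed
    have "\<exists>u\<in>worlds G. \<forall>z\<in>points G. (u, z) \<notin> rel G 0" using rep[of "{}"] by simp
    \<comment> \<open>Here \<open>u\<close> may lie outside \<open>F\<close>; enlarging the set it
      sees is still possible because \<open>rep\<close> covers every set of points.\<close>
    moreover have "\<exists>v\<in>worlds G. \<forall>z\<in>points G. (v, z) \<in> rel G 0 \<longleftrightarrow> (u, z) \<in> rel G 0 \<or> z = x"
      if "x \<in> points G" for u x
      using rep[of "{z \<in> points G. (u, z) \<in> rel G 0 \<or> z = x}"] by simp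
    moreover have "points G \<noteq> {}" using p pts by auto
    ultimately have "insert_closed G" unfolding insert_closed_def by blast
    then show False using nG by simp
  qed
  then show "F \<Turnstile> chi" using cF models_chi[OF ne(1)] by simp
qed

section \<open>Frames of points and sets of points\<close>

text \<open>The sum type keeps points and sets apart. Nothing sees a set, so a quantifier bounded by
  the relation ranges over points only.\<close>

definition set_frame :: "nat set \<Rightarrow> nat set set \<Rightarrow> (nat, nat + nat set) frame" where
  "set_frame D E = \<lparr>worlds = Inl ` D \<union> Inr ` E,
     rel = (\<lambda>_. {(Inl x, Inl y) |x y. x \<in> D \<and> y \<in> D} \<union> {(Inr X, Inl y) |X y. X \<in> E \<and> y \<in> X})\<rparr>"

lemma worlds_set_frame: "worlds (set_frame D E) = Inl ` D \<union> Inr ` E"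
  by (simp add: set_frame_def)

lemma rel_set_frame [simp]:
  "(Inl x, Inl y) \<in> rel (set_frame D E) a \<longleftrightarrow> x \<in> D \<and> y \<in> D"
  "(Inr X, Inl y) \<in> rel (set_frame D E) a \<longleftrightarrow> X \<in> E \<and> y \<in> X"
  "(u, Inr X) \<notin> rel (set_frame D E) a"
  by (auto simp: set_frame_def)

lemma finite_frame_set_frame:
  assumes "finite D" "D \<noteq> {}" "E \<subseteq> Pow D"
  shows "finite_frame A (set_frame D E)"
proof -
  have "finite E" using assms finite_subset[of E "Pow D"] by simp
  then show ?thesis using assms by (auto simp: finite_frame_def is_frame_def set_frame_def)
qed

lemma points_set_frame: "points (set_frame D E) = Inl ` D"
  by (auto simp: points_def worlds_set_frame)

lemma clique_set_frame: "clique (set_frame D E)"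
  by (auto simp: clique_def points_set_frame)

lemma insert_closed_set_frame_Pow:
  assumes "D \<noteq> {}"
  shows "insert_closed (set_frame D (Pow D))"
proof -
  let ?F = "set_frame D (Pow D)"
  have rep: "\<exists>v\<in>worlds ?F. \<forall>z\<in>points ?F. (v, z) \<in> rel ?F 0 \<longleftrightarrow> P z" for P
  proof (rule bexI)
    show "Inr {d \<in> D. P (Inl d)} \<in> worlds ?F" by (auto simp: worlds_set_frame)
  qed (auto simp: points_set_frame)
  have "\<exists>u\<in>worlds ?F. \<forall>z\<in>points ?F. (u, z) \<notin> rel ?F 0" using rep[of "\<lambda>_. False"] by simp
  moreover have "points ?F \<noteq> {}" using assms by (simp add: points_set_frame)
  ultimately show ?thesis unfolding insert_closed_def by (intro conjI ballI rep)
qed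

text \<open>The points themselves represent \<open>D\<close>, so \<open>D\<close> is excluded. Any
  other \<open>X\<close> must be represented by a set world, which then equals
  \<open>X\<close>.\<close>

lemma set_frame_represents:
  assumes "insert_closed (set_frame D E)" "finite D" "E \<subseteq> Pow D" "X \<subseteq> D" "X \<noteq> D"
  shows "X \<in> E"
proof -
  let ?F = "set_frame D E"
  have "finite (Inl ` X :: (nat + nat set) set)" using finite_subset[OF assms(4,2)] by simp
  then obtain u where u: "u \<in> worlds ?F"
    and eq: "\<forall>z\<in>points ?F. (u, z) \<in> rel ?F 0 \<longleftrightarrow> z \<in> Inl ` X"
    using insert_closed_represents[OF assms(1), of "Inl ` X"] assms(4)
    by (auto simp: points_set_frame)
  have iff: "(u, Inl d) \<in> rel ?F 0 \<longleftrightarrow> d \<in> X" if "d \<in> D" for d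
    using eq that by (auto simp: points_set_frame)
  show ?thesis
  proof (cases u)
    case (Inl x)
    then have "x \<in> D" using u by (auto simp: worlds_set_frame)
    then have "D \<subseteq> X" using iff Inl by auto
    then show ?thesis using assms(4,5) by auto
  next
    case (Inr Y)
    then have "Y \<in> E" using u by (auto simp: worlds_set_frame)
    moreover from this have "Y = X" using iff Inr assms(3,4) by auto
    ultimately show ?thesis by simp
  qed
qed

text \<open>These suffice for imitating a subset of a small clique inside a larger one, with the
  surplus points either all left out or all put in.\<close>

definition thin_sets :: "nat \<Rightarrow> nat set \<Rightarrow> nat set set" where
  "thin_sets N D = {X. X \<subseteq> D \<and> (card X \<le> N \<or> card (D - X) \<le> N)}"

lemma not_insert_closed_thin_sets:
  "\<not> insert_closed (set_frame {..<2 * N + 2} (thin_sets N {..<2 * N + 2}))"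
proof
  let ?D = "{..<2 * N + 2}"
  assume full: "insert_closed (set_frame ?D (thin_sets N ?D))"
  have D: "?D - {..<N + 1} = {N + 1..<2 * N + 2}" by auto
  \<comment> \<open>The first half of the \<open>2 * N + 2\<close> points and its complement both
    have \<open>N + 1\<close> elements, one too many for a thin set.\<close>
  have "{..<N + 1} \<in> thin_sets N ?D"
    by (rule set_frame_represents[OF full]) (auto simp: thin_sets_def)
  then show False using D by (simp add: thin_sets_def)
qed

section \<open>The game\<close>

primrec qrank :: "'a fm \<Rightarrow> nat" where
  "qrank (Rel a x y) = 0"
| "qrank (Eq x y) = 0"
| "qrank (Neg p) = qrank p"
| "qrank (Conj p q) = max (qrank p) (qrank q)"
| "qrank (Disj p q) = max (qrank p) (qrank q)"
| "qrank (Imp p q) = max (qrank p) (qrank q)"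
| "qrank (Ex x p) = Suc (qrank p)"
| "qrank (All x p) = Suc (qrank p)"

lemma sat_cong_free_vars:
  assumes "\<forall>x\<in>free_vars p. e x = e' x"
  shows "sat F e p \<longleftrightarrow> sat F e' p"
  using assms
proof (induction p arbitrary: e e')
  case (Ex x p)
  have "sat F (e(x := w)) p \<longleftrightarrow> sat F (e'(x := w)) p" for w
    using Ex.prems by (intro Ex.IH) auto
  then show ?case by simp
next
  case (All x p)
  have "sat F (e(x := w)) p \<longleftrightarrow> sat F (e'(x := w)) p" for w
    using All.prems by (intro All.IH) auto
  then show ?case by simp
next
  case (Conj p q)
  show ?case using Conj.IH[of e e'] Conj.prems by simp
next
  case (Disj p q)
  show ?case using Disj.IH[of e e'] Disj.prems by simp
next
  case (Imp p q)
  show ?case using Imp.IH[of e e'] Imp.prems by simp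
next
  case (Neg p)
  show ?case using Neg.IH[of e e'] Neg.prems by simp
qed auto

section \<open>Matching of the full frame with the thin frame\<close>

locale imitation =
  fixes N :: nat and D C :: "nat set"
  assumes card_D: "card D \<le> N" and finite_D: "finite D"
begin

abbreviation "F \<equiv> set_frame D (Pow D)"
abbreviation "G \<equiv> set_frame C (thin_sets N C)"

text \<open>The map \<open>h\<close> embeds the points of \<open>F\<close> into those of \<open>G\<close>, and the surplus points of \<open>G\<close>
  look like the points of the block \<open>P\<close>.\<close>

fun matched :: "(nat \<Rightarrow> nat) \<Rightarrow> nat set \<Rightarrow> nat + nat set \<Rightarrow> nat + nat set \<Rightarrow> bool" where
  "matched h P (Inl c) (Inl d) \<longleftrightarrow> d \<in> D - P \<and> c = h d"
| "matched h P (Inr Y) (Inr X) \<longleftrightarrow> Y \<in> thin_sets N C \<and> X \<subseteq> D \<and> (\<forall>d\<in>D. h d \<in> Y \<longleftrightarrow> d \<in> X) \<and>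
     (P \<subseteq> X \<and> C - h ` D \<subseteq> Y \<or> P \<inter> X = {} \<and> (C - h ` D) \<inter> Y = {})"
| "matched h P _ _ \<longleftrightarrow> False"

text \<open>Here \<open>k\<close> counts the quantifiers still to be played. A new set cuts
  \<open>P\<close> in two and the larger part is kept, so one quantifier may halve the block; at
  \<open>k = 0\<close> it is still nonempty.\<close>

definition block :: "nat \<Rightarrow> (nat \<Rightarrow> nat) \<Rightarrow> nat set \<Rightarrow> bool" where
  "block k h P \<longleftrightarrow> inj_on h D \<and> h ` D \<subseteq> C \<and> P \<subseteq> D \<and> 2 ^ k \<le> card P"

definition similar :: "nat \<Rightarrow> (nat \<Rightarrow> nat + nat set) \<Rightarrow> (nat \<Rightarrow> nat + nat set) \<Rightarrow> bool" where
  "similar k g f \<longleftrightarrow> (\<exists>h P. block k h P \<and> (\<forall>i. matched h P (g i) (f i)))"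

lemma block_nonempty: "block k h P \<Longrightarrow> P \<noteq> {}"
  by (auto simp: block_def)

text \<open>A smaller block excludes fewer points and demands less uniformity of sets, so earlier
  choices survive its shrinking.\<close>

lemma matched_mono:
  assumes "matched h P u v" "Q \<subseteq> P"
  shows "matched h Q u v"
  using assms by (cases "(h, P, u, v)" rule: matched.cases) auto

text \<open>The partner \<open>X\<close> determines \<open>Y\<close>: on the image of
  \<open>D\<close> elementwise, and on the surplus points by whether \<open>X\<close> contains or
  misses \<open>P\<close>, which are exclusive since \<open>P\<close> is nonempty.\<close>

lemma matched_eq_iff:
  assumes "block k h P" "matched h P u v" "matched h P u' v'"
  shows "u = u' \<longleftrightarrow> v = v'"
proof -
  have inj: "inj_on h D" and PD: "P \<subseteq> D" and P: "P \<noteq> {}"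
    using assms(1) block_nonempty by (auto simp: block_def)
  have sets: "Y = Y' \<longleftrightarrow> X = X'" if "matched h P (Inr Y) (Inr X)" "matched h P (Inr Y') (Inr X')"
    for X Y X' Y'
  proof
    assume "Y = Y'"
    then show "X = X'" using that by auto
  next
    assume X: "X = X'"
    have "c \<in> Y \<longleftrightarrow> c \<in> Y'" if "c \<in> C" for c
      using that X \<open>matched h P (Inr Y) (Inr X)\<close> \<open>matched h P (Inr Y') (Inr X')\<close> P PD
      by (cases "c \<in> h ` D") auto
    moreover have "Y \<subseteq> C" "Y' \<subseteq> C" using that by (auto simp: thin_sets_def)
    ultimately show "Y = Y'" by blast
  qed
  show ?thesis
  proof (cases v)
    case (Inl d)
    then show ?thesis using assms(2,3) inj by (cases u; cases u'; cases v') (auto dest: inj_onD)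
  next
    case (Inr X)
    then obtain Y where u: "u = Inr Y" using assms(2) by (cases u) auto
    show ?thesis
    proof (cases v')
      case (Inl d)
      then show ?thesis using assms(3) \<open>v = Inr X\<close> u by (cases u') auto
    next
      case (Inr X')
      then obtain Y' where "u' = Inr Y'" using assms(3) by (cases u') auto
      then show ?thesis using sets[of Y X Y' X'] assms(2,3) \<open>v = Inr X\<close> \<open>v' = Inr X'\<close> u by simp
    qed
  qed
qed

lemma matched_rel_iff:
  assumes "block k h P" "matched h P u v" "matched h P u' v'"
  shows "(u, u') \<in> rel G a \<longleftrightarrow> (v, v') \<in> rel F a"
  using assms by (cases u; cases v; cases u'; cases v') (auto simp: block_def)

lemma similar_eq_iff: "similar k g f \<Longrightarrow> g x = g y \<longleftrightarrow> f x = f y"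
  unfolding similar_def using matched_eq_iff by blast

lemma similar_rel_iff:
  "similar k g f \<Longrightarrow> (g x, g y) \<in> rel G a \<longleftrightarrow> (f x, f y) \<in> rel F a"
  unfolding similar_def using matched_rel_iff by blast

lemma block_remove:
  assumes "block (Suc k) h P"
  shows "block k h (P - {d})"
proof -
  have "2 ^ Suc k \<le> card P" using assms by (simp add: block_def)
  moreover have "card P - 1 \<le> card (P - {d})" by (simp add: card_Diff_singleton_if)
  moreover have "(1 :: nat) \<le> 2 ^ k" by simp
  ultimately have "2 ^ k \<le> card (P - {d})" unfolding power_Suc by linarith
  then show ?thesis using assms by (auto simp: block_def)
qed

lemma similar_fun_upd:
  assumes "block k h Q" "Q \<subseteq> P" "\<forall>i. matched h P (g i) (f i)" "matched h Q u v"
  shows "similar k (g(x := u)) (f(x := v))"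
proof -
  have "matched h Q (g i) (f i)" for i using matched_mono assms(2,3) by blast
  then have "\<forall>i. matched h Q ((g(x := u)) i) ((f(x := v)) i)" using assms(4) by simp
  then show ?thesis unfolding similar_def using assms(1) by blast
qed

section \<open>Answers to the moves in either frame\<close>

lemma answer_in_G:
  assumes sim: "similar (Suc k) g f" and v: "v \<in> worlds F"
  obtains u where "u \<in> worlds G" "similar k (g(x := u)) (f(x := v))"
proof -
  obtain h P where b: "block (Suc k) h P" and m: "\<forall>i. matched h P (g i) (f i)"
    using sim by (auto simp: similar_def)
  have inj: "inj_on h D" and hC: "h ` D \<subseteq> C" and PD: "P \<subseteq> D" and cP: "2 ^ Suc k \<le> card P"
    using b by (auto simp: block_def)
  show thesis
  proof (cases v)
    case (Inl d)
    then have d: "d \<in> D" using v by (auto simp: worlds_set_frame)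
    show thesis
    proof (rule that)
      show "Inl (h d) \<in> worlds G" using d hC by (auto simp: worlds_set_frame)
      \<comment> \<open>A chosen point must lie outside the block, so \<open>d\<close> is removed
        from it.\<close>
      show "similar k (g(x := Inl (h d))) (f(x := v))"
        using Inl d by (intro similar_fun_upd[OF block_remove[OF b, of d] _ m]) auto
    qed
  next
    case (Inr X)
    then have X: "X \<subseteq> D" using v by (auto simp: worlds_set_frame)
    have hX: "h d \<in> h ` X \<longleftrightarrow> d \<in> X" if "d \<in> D" for d
      using that X inj by (auto dest: inj_onD)
    have small: "card (h ` Z) \<le> N" if "Z \<subseteq> D" for Z
      using card_image_le[of Z h] card_mono[OF finite_D that] card_D finite_subset[OF that finite_D]
      by linarith
    have "card P = card (P \<inter> X) + card (P - X)"
      using card_Int_Diff finite_subset[OF PD finite_D] by blast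
    then consider "2 ^ k \<le> card (P - X)" | "2 ^ k \<le> card (P \<inter> X)"
      using cP by fastforce
    then show thesis
    proof cases
      \<comment> \<open>Half of the block lies outside \<open>X\<close>, so all surplus points are
        left out; the image of \<open>X\<close> has at most \<open>N\<close> elements.\<close>
      case 1
      show thesis
      proof (rule that)
        have Y: "h ` X \<in> thin_sets N C" using small[OF X] X hC by (auto simp: thin_sets_def)
        then show "Inr (h ` X) \<in> worlds G" by (auto simp: worlds_set_frame)
        have "block k h (P - X)" using b 1 by (auto simp: block_def)
        moreover have "matched h (P - X) (Inr (h ` X)) v" using Inr X Y hX by auto
        ultimately show "similar k (g(x := Inr (h ` X))) (f(x := v))"
          using m by (intro similar_fun_upd[of k h "P - X" P]) auto
      qed
    next
      \<comment> \<open>Half of the block lies inside \<open>X\<close>, so all surplus points are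
        put in; the complement then lies in the image of \<open>D\<close> and has at most
        \<open>N\<close> elements.\<close>
      case 2
      let ?Y = "h ` X \<union> (C - h ` D)"
      show thesis
      proof (rule that)
        have "C - ?Y \<subseteq> h ` D" using hC by auto
        then have "card (C - ?Y) \<le> card (h ` D)"
          using finite_D by (intro card_mono) auto
        then have Y: "?Y \<in> thin_sets N C"
          using small[of D] X hC by (auto simp: thin_sets_def)
        then show "Inr ?Y \<in> worlds G" by (auto simp: worlds_set_frame)
        have "block k h (P \<inter> X)" using b 2 by (auto simp: block_def)
        moreover have "matched h (P \<inter> X) (Inr ?Y) v" using Inr X Y hX by auto
        ultimately show "similar k (g(x := Inr ?Y)) (f(x := v))"
          using m by (intro similar_fun_upd[of k h "P \<inter> X" P]) auto
      qed
    qed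
  qed
qed

text \<open>No point chosen so far lies in the block, and every chosen set treats the block and the
  surplus points uniformly. Hence \<open>p\<close> may be mapped to the surplus point
  \<open>c\<close> instead, and \<open>h p\<close> becomes surplus.\<close>

lemma matched_exchange:
  assumes b: "block k h P" and p: "p \<in> P" and c: "c \<in> C - h ` D" and m: "matched h P u v"
  shows "matched (h(p := c)) P u v"
proof -
  have PD: "P \<subseteq> D" using b by (simp add: block_def)
  have im: "c' = h p \<or> c' \<in> C - h ` D" if "c' \<in> C - (h(p := c)) ` D" for c'
    using that by (auto simp: image_iff)
  show ?thesis
  proof (cases "(h, P, u, v)" rule: matched.cases)
    case (1 h' P' c' d)
    then show ?thesis using m p by auto
  next
    case (2 h' P' Y X)
    then have uv: "u = Inr Y" "v = Inr X" by auto
    have Y: "Y \<in> thin_sets N C" and X: "X \<subseteq> D" and hd: "\<And>d. d \<in> D \<Longrightarrow> h d \<in> Y \<longleftrightarrow> d \<in> X"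
      and P: "P \<subseteq> X \<and> C - h ` D \<subseteq> Y \<or> P \<inter> X = {} \<and> (C - h ` D) \<inter> Y = {}"
      using m uv by auto
    have cY: "c \<in> Y \<longleftrightarrow> p \<in> X" using P p c by auto
    have hp: "h p \<in> Y \<longleftrightarrow> p \<in> X" using hd p PD by auto
    have "\<forall>d\<in>D. (h(p := c)) d \<in> Y \<longleftrightarrow> d \<in> X" using hd cY by simp
    moreover have "P \<subseteq> X \<and> S \<subseteq> Y \<or> P \<inter> X = {} \<and> S \<inter> Y = {}" if S: "S = C - (h(p := c)) ` D" for S
    proof -
      have "c' \<in> Y \<longleftrightarrow> p \<in> X" if "c' \<in> S" for c'
        using im[of c'] that S hp P p by auto
      then show ?thesis using P p by blast
    qed
    ultimately show ?thesis unfolding uv matched.simps using X Y by blast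
  qed (use m in auto)
qed

lemma block_exchange:
  assumes b: "block k h P" and p: "p \<in> P" and c: "c \<in> C - h ` D"
  shows "block k (h(p := c)) P"
  using assms unfolding block_def by (auto intro: inj_on_fun_updI)

text \<open>Only points have to be answered in this direction. A surplus point is first exchanged
  with the image of a block element, which then serves as the answer.\<close>

lemma answer_in_F:
  assumes sim: "similar (Suc k) g f" and c: "c \<in> C"
  obtains v where "v \<in> worlds F" "similar k (g(x := Inl c)) (f(x := v))"
proof -
  obtain h P where b: "block (Suc k) h P" and m: "\<forall>i. matched h P (g i) (f i)" and "c \<in> h ` D"
  proof -
    obtain h P where b: "block (Suc k) h P" and m: "\<forall>i. matched h P (g i) (f i)"
      using sim by (auto simp: similar_def)
    show thesis
    proof (cases "c \<in> h ` D")
      case True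
      then show thesis using that b m by blast
    next
      case False
      obtain p where p: "p \<in> P" using block_nonempty[OF b] by auto
      then have "c \<in> (h(p := c)) ` D" using b by (auto simp: block_def)
      then show thesis
        using that[OF block_exchange[OF b p]] matched_exchange[OF b p] False c m by blast
    qed
  qed
  then obtain d where d: "d \<in> D" "c = h d" by auto
  show thesis
  proof (rule that)
    show "Inl d \<in> worlds F" using d by (auto simp: worlds_set_frame)
    show "similar k (g(x := Inl c)) (f(x := Inl d))"
      using d by (intro similar_fun_upd[OF block_remove[OF b, of d] _ m]) auto
  qed
qed

text \<open>Truth moves only from \<open>G\<close> to \<open>F\<close>: universal quantifiers pose
  worlds of \<open>F\<close> to be answered in \<open>G\<close>, while existential witnesses in
  \<open>G\<close> are answered in \<open>F\<close>. Literals transfer because similarity respects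
  equality and the relation both ways.\<close>

lemma ex_bounded_transfer:
  assumes "ex_bounded p" "qrank p \<le> k" "similar k g f" "sat G g p"
  shows "sat F f p"
  using assms
proof (induction p arbitrary: k g f)
  case (1 a x y)
  then show ?case using similar_rel_iff by simp
next
  case (2 a x y)
  then show ?case using similar_rel_iff by simp
next
  case (3 x y)
  then show ?case using similar_eq_iff by simp
next
  case (4 x y)
  then show ?case using similar_eq_iff by simp
next
  case (7 y x p a)
  then obtain j where k: "k = Suc j" "qrank p \<le> j" by (cases k) auto
  obtain u where u: "(g y, u) \<in> rel G a" "sat G (g(x := u)) p"
    using 7 by auto
  \<comment> \<open>The bound makes the witness a successor, hence a point; a set witness could not
    be answered by \<open>answer_in_F\<close>.\<close>
  then obtain c where c: "u = Inl c" "c \<in> C"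
    by (cases u; cases "g y") (auto simp: thin_sets_def)
  obtain v where v: "v \<in> worlds F" "similar j (g(x := u)) (f(x := v))"
    using answer_in_F 7 k c by metis
  have "(f y, v) \<in> rel F a"
    using similar_rel_iff[OF v(2), of y x a] u(1) \<open>y \<noteq> x\<close> by simp
  moreover have "sat F (f(x := v)) p" using 7 k v u by blast
  ultimately show ?case using v(1) \<open>y \<noteq> x\<close> by auto
next
  case (8 y x p a)
  then obtain j where k: "k = Suc j" "qrank p \<le> j" by (cases k) auto
  have "sat F (f(x := v)) p" if v: "v \<in> worlds F" "(f y, v) \<in> rel F a" for v
  proof -
    obtain u where u: "u \<in> worlds G" "similar j (g(x := u)) (f(x := v))"
      using answer_in_G 8 k v by metis
    have "(g y, u) \<in> rel G a"
      using similar_rel_iff[OF u(2), of y x a] v(2) \<open>y \<noteq> x\<close> by simp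
    then have "sat G (g(x := u)) p" using 8 u(1) by auto
    then show ?thesis using 8 k u by blast
  qed
  then show ?case using \<open>y \<noteq> x\<close> by auto
next
  case (9 p x)
  then obtain j where k: "k = Suc j" "qrank p \<le> j" by (cases k) auto
  have "sat F (f(x := v)) p" if v: "v \<in> worlds F" for v
  proof -
    obtain u where u: "u \<in> worlds G" "similar j (g(x := u)) (f(x := v))"
      using answer_in_G 9 k v by metis
    then show ?thesis using 9 k by auto
  qed
  then show ?case by simp
qed auto

end

section \<open>Separation of \<open>chi\<close> from all \<open>ex_bounded\<close> sentences\<close>

lemma models_transfer:
  fixes N :: nat
  defines "F \<equiv> set_frame {..<N} (Pow {..<N})"
    and "G \<equiv> set_frame {..<2 * N + 2} (thin_sets N {..<2 * N + 2})"
  assumes \<psi>: "ex_bounded \<psi>" "free_vars \<psi> = {}" "2 ^ qrank \<psi> \<le> N" and G: "G \<Turnstile> \<psi>"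
  shows "F \<Turnstile> \<psi>"
proof -
  interpret imitation N "{..<N}" "{..<2 * N + 2}" by unfold_locales auto
  \<comment> \<open>The game starts with all of \<open>{..<N}\<close> as block, so no point can be
    matched yet; the empty set matches itself and serves as value of every variable.\<close>
  let ?e = "\<lambda>_ :: nat. Inr {} :: nat + nat set"
  have thin: "{} \<in> thin_sets N {..<2 * N + 2}" by (simp add: thin_sets_def)
  have "block (qrank \<psi>) id {..<N}" unfolding block_def using \<psi>(3) by auto
  moreover have "matched id {..<N} (Inr {}) (Inr {})"
    unfolding matched.simps using thin by blast
  ultimately have "similar (qrank \<psi>) ?e ?e" unfolding similar_def by blast
  moreover have "sat G ?e \<psi>" using G thin by (auto simp: models_def G_def worlds_set_frame)
  ultimately have "sat F ?e \<psi>"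
    using ex_bounded_transfer[OF \<psi>(1) order.refl] unfolding F_def G_def by blast
  then show ?thesis
    unfolding models_def using sat_cong_free_vars[of \<psi>] \<psi>(2) by blast
qed

theorem theorem3p10:
  shows "\<exists>(A :: nat set) (\<chi> :: nat fm).
    finite A \<and> sentence A \<chi> \<and> preserved_generated_subframes_fin A \<chi> \<and>
    \<not> (\<exists>\<psi>. sentence A \<psi> \<and> ex_bounded \<psi> \<and> equivalent_fin A \<chi> \<psi>)"
proof (intro exI conjI)
  show "finite {0 :: nat}" by simp
  show "sentence {0} chi" by (rule sentence_chi)
  show "preserved_generated_subframes_fin {0} chi" by (rule preserved_chi)
  show "\<not> (\<exists>\<psi>. sentence {0} \<psi> \<and> ex_bounded \<psi> \<and> equivalent_fin {0} chi \<psi>)"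
  proof
    assume "\<exists>\<psi>. sentence {0} \<psi> \<and> ex_bounded \<psi> \<and> equivalent_fin {0} chi \<psi>"
    then obtain \<psi> where \<psi>: "sentence {0} \<psi>" "ex_bounded \<psi>" and eq: "equivalent_fin {0} chi \<psi>"
      by blast
    \<comment> \<open>This is the size an initial block needs to survive all quantifiers of
      \<open>\<psi>\<close>.\<close>
    define N :: nat where "N = 2 ^ qrank \<psi>"
    let ?F = "set_frame {..<N} (Pow {..<N})"
    let ?G = "set_frame {..<2 * N + 2} (thin_sets N {..<2 * N + 2})"
    have N: "{..<N} \<noteq> {}" by (auto simp: N_def lessThan_empty_iff)
    have finF: "finite_frame {0} ?F" using N by (intro finite_frame_set_frame) auto
    have finG: "finite_frame {0} ?G"
      by (intro finite_frame_set_frame) (auto simp: thin_sets_def lessThan_empty_iff)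
    \<comment> \<open>Equivalence is stated for worlds in \<open>nat\<close>; here it is carried
      over to the sum type of the two frames.\<close>
    have equiv: "H \<Turnstile> chi \<longleftrightarrow> H \<Turnstile> \<psi>" if "finite_frame {0} H"
      for H :: "(nat, nat + nat set) frame"
      using equivalent_fin_any_type[OF eq _ _ that] sentence_chi \<psi>(1)
      by (auto simp: sentence_def)
    have ne: "worlds ?F \<noteq> {}" "worlds ?G \<noteq> {}"
      using finF finG by (auto simp: finite_frame_def is_frame_def)
    have "?G \<Turnstile> chi"
      using models_chi[OF ne(2)] clique_set_frame not_insert_closed_thin_sets by blast
    then have "?G \<Turnstile> \<psi>" using equiv[OF finG] by simp
    then have "?F \<Turnstile> \<psi>"
      using \<psi> by (intro models_transfer) (auto simp: sentence_def N_def)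
    then have "?F \<Turnstile> chi" using equiv[OF finF] by simp
    then show False using models_chi[OF ne(1)] insert_closed_set_frame_Pow[OF N] by blast
  qed
qed

end
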